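(* Let $p\ge2$ be an integer, $\nu\in[0,1]$, and consider $\mathbb{R}^n$ with the standard Euclidean norm. Let $\mathcal{M}$ be a $p$-order tensor method on $\mathbb{R}^n$ satisfying Assumption 1 (stated in the context). Assume that for any convex $p$-times differentiable function $f:\mathbb{R}^n\to\mathbb{R}$ with $H_{f,p}(\nu)<+\infty$ possessing a global minimizer, this method ensures the rate of convergence $$\min_{0\le k\le t}f(x_k)-f^*\le\frac{H_{f,p}(\nu)\,\|x_0-x^*\|^{p+\nu}}{\kappa(t)},\qquad t\ge1,$$ where $\{x_k\}_{k\ge0}$ is the sequence generated by $\mathcal{M}$ applied to $f$ from the starting point $x_0$, $x^*$ is a global minimizer of $f$, $f^*=f(x^* )$, and $\kappa(t)>0$ depends only on $t$ (not on $f$ or $x_0$). Then, for all $t\ge1$ such that $2t+1\le n$, $$\kappa(t)\le C_{p,\nu}\,(t+1)^{\frac{3(p+\nu)-2}{2}},\qquad\text{where}\quad C_{p,\nu}=\frac{2^{\frac{3p+4\nu+2}{2}}\prod_{i=0}^{p-1}(p+\nu-i)}{3^{\frac{p+\nu}2}(p+\nu-1)}.$$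
   Context: The Hölder constant is $H_{f,p}(\nu)=\sup_{x\ne y}\frac{\|D^pf(x)-D^pf(y)\|}{\|x-y\|^\nu}$, where $\|D^pf(x)-D^pf(y)\|=\max_{\|h\|\le1}|D^pf(x)[h]^p-D^pf(y)[h]^p|$. For $\bar x\in\mathbb{R}^n$, $a\in\mathbb{R}^p$, $\gamma>0$, $m>1$, let $$\phi_{a,\gamma,m}(h)=\sum_{i=1}^pa^{(i)}D^if(\bar x)[h]^i+\gamma\|h\|^m,\qquad h\in\mathbb{R}^n,$$ let $\Gamma_{\bar x,f}(a,\gamma,m)$ be the set of all stationary points of $\phi_{a,\gamma,m}$, and let $S_f(\bar x)$ be the linear subspace spanned by $\bigcup\{\Gamma_{\bar x,f}(a,\gamma,m): a\in\mathbb{R}^p,\gamma>0,m>1\}$. Assumption 1. Given a starting point $x_0\in\mathbb{R}^n$ and an objective $f$, the method generates a sequence of test points $\{x_k\}_{k\ge0}$ such that $$x_{k+1}\in x_0+\sum_{i=0}^kS_f(x_i),\qquad k\ge0.$$ *)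

theory Defs
  imports "HOL-Analysis.Analysis"
begin

(* dform f [h1, ..., hk] x is the value D^k f(x)[h1, ..., hk] of the k-th Frechet
   derivative, regarded as a k-linear form: D^(k+1) f(x)[h, h1, ..., hk] is the
   derivative of y |-> D^k f(y)[h1, ..., hk] at x in direction h. *)
fun dform :: "('a::euclidean_space \<Rightarrow> real) \<Rightarrow> 'a list \<Rightarrow> 'a \<Rightarrow> real" where
  "dform f [] x = f x"
| "dform f (h # hs) x = frechet_derivative (dform f hs) (at x) h"

definition dpow :: "('a::euclidean_space \<Rightarrow> real) \<Rightarrow> nat \<Rightarrow> 'a \<Rightarrow> 'a \<Rightarrow> real" where
  "dpow f i x h = dform f (replicate i h) x"

(* The space of k-linear forms is finite dimensional, so the map D^k f is Frechet
   differentiable iff all its evaluations x |-> D^k f(x)[h1, ..., hk] are.  Continuity of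
   D^p f is not required. *)
definition times_differentiable :: "nat \<Rightarrow> ('a::euclidean_space \<Rightarrow> real) \<Rightarrow> bool" where
  "times_differentiable p f \<longleftrightarrow>
     (\<forall>hs x. length hs < p \<longrightarrow> dform f hs differentiable (at x))"

(* For p-times differentiable f the supremum is over a continuous function on the compact
   unit ball, hence it is a maximum. *)
definition dpow_dist :: "('a::euclidean_space \<Rightarrow> real) \<Rightarrow> nat \<Rightarrow> 'a \<Rightarrow> 'a \<Rightarrow> real" where
  "dpow_dist f p x y = (SUP h\<in>cball 0 1. \<bar>dpow f p x h - dpow f p y h\<bar>)"

definition holder_const :: "('a::euclidean_space \<Rightarrow> real) \<Rightarrow> nat \<Rightarrow> real \<Rightarrow> ennreal" where
  "holder_const f p \<nu> =
     (SUP (x, y)\<in>{(x, y). x \<noteq> y}. ennreal (dpow_dist f p x y / norm (x - y) powr \<nu>))"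

(* A vector a in R^p is represented by a function on the indices 1..p; its other
   values are irrelevant. *)
definition reg_model ::
  "nat \<Rightarrow> ('a::euclidean_space \<Rightarrow> real) \<Rightarrow> 'a \<Rightarrow> (nat \<Rightarrow> real) \<Rightarrow> real \<Rightarrow> real \<Rightarrow> 'a \<Rightarrow> real" where
  "reg_model p f xb a \<gamma> m h = (\<Sum>i=1..p. a i * dpow f i xb h) + \<gamma> * norm h powr m"

definition stationary_points ::
  "nat \<Rightarrow> ('a::euclidean_space \<Rightarrow> real) \<Rightarrow> 'a \<Rightarrow> (nat \<Rightarrow> real) \<Rightarrow> real \<Rightarrow> real \<Rightarrow> 'a set" where
  "stationary_points p f xb a \<gamma> m =
     {h. (reg_model p f xb a \<gamma> m has_derivative (\<lambda>_. 0)) (at h)}"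

definition step_space :: "nat \<Rightarrow> ('a::euclidean_space \<Rightarrow> real) \<Rightarrow> 'a \<Rightarrow> 'a set" where
  "step_space p f xb =
     span (\<Union>{stationary_points p f xb a \<gamma> m | a \<gamma> m. \<gamma> > 0 \<and> m > 1})"

definition tensor_steps ::
  "nat \<Rightarrow> ('a::euclidean_space \<Rightarrow> real) \<Rightarrow> (nat \<Rightarrow> 'a) \<Rightarrow> bool" where
  "tensor_steps p f x \<longleftrightarrow>
     (\<forall>k. \<exists>s. (\<forall>i\<le>k. s i \<in> step_space p f (x i)) \<and> x (Suc k) = x 0 + (\<Sum>i\<le>k. s i))"

definition global_minimizer :: "('a \<Rightarrow> real) \<Rightarrow> 'a \<Rightarrow> bool" where
  "global_minimizer f xs \<longleftrightarrow> (\<forall>y. f xs \<le> f y)"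

definition admissible_objective ::
  "nat \<Rightarrow> real \<Rightarrow> ('a::euclidean_space \<Rightarrow> real) \<Rightarrow> bool" where
  "admissible_objective p \<nu> f \<longleftrightarrow>
     convex_on UNIV f \<and> times_differentiable p f \<and> holder_const f p \<nu> < \<infinity> \<and>
     (\<exists>xs. global_minimizer f xs)"

(* A method maps an objective and a starting point x0 to the sequence of test points;
   it is unconstrained outside the class of objectives to which it is applied. *)
definition tensor_method ::
  "nat \<Rightarrow> real \<Rightarrow> (('a::euclidean_space \<Rightarrow> real) \<Rightarrow> 'a \<Rightarrow> nat \<Rightarrow> 'a) \<Rightarrow> bool" where
  "tensor_method p \<nu> M \<longleftrightarrow>
     (\<forall>f x0. admissible_objective p \<nu> f \<longrightarrow> M f x0 0 = x0 \<and> tensor_steps p f (M f x0))"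

definition rate_const :: "nat \<Rightarrow> real \<Rightarrow> real" where
  "rate_const p \<nu> =
     2 powr ((3 * real p + 4 * \<nu> + 2) / 2) * (\<Prod>i=0..p-1. real p + \<nu> - real i)
       / (3 powr ((real p + \<nu>) / 2) * (real p + \<nu> - 1))"

end

theory Submission
  imports Defs
begin

text \<open>
  With $q = p + \nu$ and $k = 2t+1$, the hard objective is the chain
  $f(x) = \sum_{i=0}^{k} g(x_i - x_{i+1})$ anchored at $x_0 = 1$ and $x_{k+1} = 0$, where
  $g(\tau) = \max(\tau,0)^q/q$. All derivatives of $g$ up to order $p$ vanish at $0$, so, when
  started at the origin, each step of the method makes at most one further coordinate nonzero and
  $x_{t+1} = 0$ still holds for the first $t+1$ test points. By Jensen's inequality $f$ is then at least
  $(t+1)^{1-q}/q$, whereas its minimum $(2t+2)^{1-q}/q$ is attained on the linear profile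
  $x_i = 1 - i/(k+1)$, whose squared norm is at most $(k+1)/3$. The Hoelder constant of $D^p f$ is at most
  $2^{q/2+1} \prod_{i=1}^{p-1}(q-i)$, and the stated constant follows from
  $q - 1 \le 2^{p/2+\nu}(1 - 2^{1-q})$, an equality for $p = 2$, $\nu = 0$. Anchoring both ends, rather
  than adding a linear term as in the usual worst-case functions, is what makes this constant
  reachable.

  For $\nu = 0$ the function $\max(\tau,0)^p/p$ is not $p$ times differentiable at $0$; it is replaced
  by the difference quotients of $\max(\tau,0)^{p+1}/(p(p+1))$, whose $p$-th derivatives oscillate by
  no more than $(p-1)!$, and one passes to the limit.
\<close>

section \<open>Chains of ridge functions\<close>

text \<open>\<open>G j\<close> is the \<open>j\<close>-th derivative of the profile \<open>G 0\<close>.\<close>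

locale smooth_profile =
  fixes G :: "nat \<Rightarrow> real \<Rightarrow> real" and p :: nat and \<nu> L :: real
  assumes p_ge_2: "2 \<le> p"
    and \<nu>_nonneg: "0 \<le> \<nu>"
    and deriv: "\<And>j \<tau>. j < p \<Longrightarrow> (G j has_real_derivative G (Suc j) \<tau>) (at \<tau>)"
    and vanish_at_0: "\<And>j. j \<le> p \<Longrightarrow> G j 0 = 0"
    and nonneg: "\<And>\<tau>. 0 \<le> G 0 \<tau>"
    and curvature_nonneg: "\<And>\<tau>. 0 \<le> G 2 \<tau>"
    and hoelder: "\<And>a b. \<bar>G p a - G p b\<bar> \<le> L * \<bar>a - b\<bar> powr \<nu>"
begin

lemma L_nonneg: "0 \<le> L"
  using hoelder[of 1 0] by simp

lemma convex_profile: "convex_on UNIV (G 0)"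
proof (rule f''_ge0_imp_convex)
  show "(G 0 has_real_derivative G 1 \<tau>) (at \<tau>)" for \<tau>
    using deriv[of 0] p_ge_2 by simp
  show "(G 1 has_real_derivative G 2 \<tau>) (at \<tau>)" for \<tau>
    using deriv[of 1] p_ge_2 by (simp add: numeral_2_eq_2)
qed (auto simp: curvature_nonneg)

text \<open>Jensen's inequality with equal weights: the increments sum to 1, so their mean is
  \<open>1 / T\<close>.\<close>

lemma jensen_telescope:
  assumes "c 0 - c T = 1" and "0 < T"
  shows "real T * G 0 (1 / real T) \<le> (\<Sum>i<T. G 0 (c i - c (Suc i)))"
proof -
  have "G 0 (\<Sum>i<T. (1 / real T) *\<^sub>R (c i - c (Suc i)))
      \<le> (\<Sum>i<T. (1 / real T) * G 0 (c i - c (Suc i)))"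
    using \<open>0 < T\<close> by (intro convex_on_sum[OF _ _ convex_profile]) auto
  also have "(\<Sum>i<T. (1 / real T) *\<^sub>R (c i - c (Suc i))) = 1 / real T"
    using sum_lessThan_telescope'[of c T] assms by (simp flip: sum_divide_distrib)
  also have "(\<Sum>i<T. (1 / real T) * G 0 (c i - c (Suc i)))
      = (\<Sum>i<T. G 0 (c i - c (Suc i))) / real T"
    by (simp add: sum_divide_distrib)
  finally show ?thesis
    using \<open>0 < T\<close> by (simp add: field_simps)
qed

end

text \<open>
  Since \<open>b 0 = b (Suc k) = 0\<close>, both end terms of the chain are links of the general form; the anchor
  $x_0 = 1$ enters as the summand \<open>of_bool (i = 0)\<close>.
\<close>

locale chain_instance = smooth_profile G p \<nu> L
  for G :: "nat \<Rightarrow> real \<Rightarrow> real" and p :: nat and \<nu> L :: real +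
  fixes b :: "nat \<Rightarrow> 'a::euclidean_space" and k :: nat
  assumes b_0: "b 0 = 0"
    and b_beyond: "\<And>i. k < i \<Longrightarrow> b i = 0"
    and b_Basis: "\<And>i. i \<in> {1..k} \<Longrightarrow> b i \<in> Basis"
    and b_inj: "inj_on b {1..k}"
begin

definition link :: "nat \<Rightarrow> 'a \<Rightarrow> real" where
  "link i h = h \<bullet> (b i - b (Suc i))"

definition chain :: "'a \<Rightarrow> real" where
  "chain x = (\<Sum>i\<le>k. G 0 (of_bool (i = 0) + link i x))"

text \<open>The chain coordinates with both anchors included: as \<open>b\<close> vanishes at 0 and
  beyond \<open>k\<close>, \<open>coord x 0 = 1\<close> and
  \<open>coord x (Suc k) = 0\<close>.\<close>

definition coord :: "'a \<Rightarrow> nat \<Rightarrow> real" where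
  "coord x i = of_bool (i = 0) + x \<bullet> b i"

text \<open>Linear interpolation between the anchors: all drops equal \<open>1 / Suc k\<close>, so
  Jensen's inequality becomes an equality.\<close>

definition minimizer :: 'a where
  "minimizer = (\<Sum>i=1..k. (1 - real i / real (Suc k)) *\<^sub>R b i)"

section \<open>The orthonormal family and the links\<close>

lemma b_inner: "b i \<bullet> b j = of_bool (i = j \<and> i \<in> {1..k})"
proof (cases "i \<in> {1..k} \<and> j \<in> {1..k}")
  case True
  then show ?thesis
    using b_Basis[of i] b_Basis[of j] b_inj by (auto simp: inner_Basis inj_on_eq_iff)
next
  case False
  then have "b i = 0 \<or> b j = 0"
    using b_0 b_beyond by (metis atLeastAtMost_iff less_one linorder_not_less)
  with False show ?thesis
    by (auto simp del: of_bool_eq)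
qed

lemma link_add: "link i (x + y) = link i x + link i y"
  and link_diff: "link i (x - y) = link i x - link i y"
  and link_scaleR: "link i (r *\<^sub>R x) = r * link i x"
  by (simp_all add: link_def inner_add_left inner_diff_left)

lemma link_eq: "link i h = h \<bullet> b i - h \<bullet> b (Suc i)"
  by (simp add: link_def inner_diff_right)

lemma coord_diff: "of_bool (i = 0) + link i x = coord x i - coord x (Suc i)"
  by (simp add: coord_def link_eq)

lemma bessel: "(\<Sum>i\<in>{1..k}. (h \<bullet> b i)\<^sup>2) \<le> (norm h)\<^sup>2"
proof -
  have "(\<Sum>i\<in>{1..k}. (h \<bullet> b i)\<^sup>2) = (\<Sum>e\<in>b ` {1..k}. (h \<bullet> e)\<^sup>2)"
    using b_inj by (simp add: sum.reindex)
  also have "\<dots> \<le> (\<Sum>e\<in>Basis. (h \<bullet> e)\<^sup>2)"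
    using b_Basis by (intro sum_mono2) auto
  also have "\<dots> = (norm h)\<^sup>2"
    unfolding power2_norm_eq_inner euclidean_inner[of h h] by (simp add: power2_eq_square)
  finally show ?thesis .
qed

lemma link_le: "\<bar>link i h\<bar> \<le> sqrt 2 * norm h"
proof -
  have "norm (b i - b (Suc i)) \<le> sqrt 2"
    by (rule real_le_rsqrt) (simp add: power2_norm_eq_inner inner_diff_left inner_diff_right b_inner)
  moreover have "\<bar>link i h\<bar> \<le> norm h * norm (b i - b (Suc i))"
    unfolding link_def by (rule Cauchy_Schwarz_ineq2)
  ultimately show ?thesis
    by (metis mult.commute mult_left_mono norm_ge_zero order_trans)
qed

text \<open>Each coordinate enters at most two links, and \<open>(u - v)^2 <= 2 u^2 + 2 v^2\<close>.
  With Bessel's inequality the factor 4 does not depend on \<open>k\<close>.\<close>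

lemma sum_link_sq_le: "(\<Sum>i\<le>k. (link i h)\<^sup>2) \<le> 4 * (norm h)\<^sup>2"
proof -
  have "(link i h)\<^sup>2 \<le> 2 * (h \<bullet> b i)\<^sup>2 + 2 * (h \<bullet> b (Suc i))\<^sup>2" for i
    using zero_le_power2[of "h \<bullet> b i + h \<bullet> b (Suc i)"]
    unfolding link_eq by (simp add: power2_sum power2_diff)
  then have "(\<Sum>i\<le>k. (link i h)\<^sup>2)
      \<le> (\<Sum>i\<le>k. 2 * (h \<bullet> b i)\<^sup>2 + 2 * (h \<bullet> b (Suc i))\<^sup>2)"
    by (intro sum_mono)
  also have "\<dots> = 2 * (\<Sum>i\<le>k. (h \<bullet> b i)\<^sup>2) + 2 * (\<Sum>i\<le>k. (h \<bullet> b (Suc i))\<^sup>2)"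
    by (simp add: sum.distrib sum_distrib_left)
  also have "(\<Sum>i\<le>k. (h \<bullet> b i)\<^sup>2) = (\<Sum>i\<in>{1..k}. (h \<bullet> b i)\<^sup>2)"
    by (rule sum.mono_neutral_right) (auto simp: b_0 not_less_eq_eq dest!: le_antisym)
  also have "(\<Sum>i\<le>k. (h \<bullet> b (Suc i))\<^sup>2) = (\<Sum>i\<in>Suc ` {..k}. (h \<bullet> b i)\<^sup>2)"
    by (simp add: sum.reindex)
  also have "\<dots> = (\<Sum>i\<in>{1..k}. (h \<bullet> b i)\<^sup>2)"
    by (rule sum.mono_neutral_right) (auto simp: b_beyond image_iff Suc_le_eq gr0_conv_Suc)
  finally show ?thesis
    using bessel[of h] by linarith
qed

section \<open>Derivatives and Hoelder constant of the chain\<close>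

text \<open>Each link is linear, so differentiating in direction \<open>h\<close> turns
  \<open>G j\<close> into \<open>G (Suc j)\<close> and brings out a factor
  \<open>link i h\<close>.\<close>

lemma dform_chain:
  assumes "length hs \<le> p"
  shows "dform chain hs = (\<lambda>x. \<Sum>i\<le>k.
    G (length hs) (of_bool (i = 0) + link i x) * prod_list (map (link i) hs))"
    and "length hs < p \<Longrightarrow> dform chain hs differentiable (at x)"
proof -
  define F where "F hs x = (\<Sum>i\<le>k.
    G (length hs) (of_bool (i = 0) + link i x) * prod_list (map (link i) hs))" for hs x
  have F: "(F hs has_derivative (\<lambda>h. F' h)) (at x)"
    if "length hs < p" "F' = (\<lambda>h. F (h # hs) x)" for hs x F'
  proof -
    have "((\<lambda>x. G (length hs) (of_bool (i = 0) + link i x)) has_derivative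
        (\<lambda>h. G (Suc (length hs)) (of_bool (i = 0) + link i x) * link i h)) (at x)" for i
    proof (rule has_derivative_compose[of "\<lambda>x. of_bool (i = 0) + link i x" "link i" x UNIV
          "G (length hs)" "\<lambda>h. G (Suc (length hs)) (of_bool (i = 0) + link i x) * h", simplified])
      show "((\<lambda>x. of_bool (i = 0) + link i x) has_derivative link i) (at x)"
        unfolding link_def by (auto intro!: derivative_eq_intros)
      show "(G (length hs) has_derivative (*) (G (Suc (length hs)) (of_bool (i = 0) + link i x)))
          (at (of_bool (i = 0) + link i x))"
        using deriv[OF that(1)] by (simp add: has_field_derivative_def)
    qed
    then show ?thesis
      unfolding F_def that(2)
      by (auto intro!: derivative_eq_intros simp: fun_eq_iff mult_ac)
  qed
  have eq: "dform chain hs = F hs" if "length hs \<le> p" for hs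
    using that
  proof (induction hs)
    case Nil
    show ?case by (simp add: fun_eq_iff F_def chain_def)
  next
    case (Cons h hs)
    then have "dform chain hs = F hs" by simp
    moreover have "frechet_derivative (F hs) (at x) = (\<lambda>h. F (h # hs) x)" for x
      using Cons.prems by (intro frechet_derivative_at[symmetric] F) auto
    ultimately show ?case by (intro ext) simp
  qed
  show "dform chain hs = (\<lambda>x. \<Sum>i\<le>k.
    G (length hs) (of_bool (i = 0) + link i x) * prod_list (map (link i) hs))"
    using eq[OF assms] by (simp add: fun_eq_iff F_def)
  show "dform chain hs differentiable (at x)" if "length hs < p"
    using F[OF that refl] eq[OF assms] by (auto simp: differentiable_def)
qed

lemma times_differentiable_chain: "times_differentiable p chain"
  unfolding times_differentiable_def using dform_chain(2) by (simp add: less_imp_le)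

lemma dpow_chain:
  assumes "j \<le> p"
  shows "dpow chain j x h = (\<Sum>i\<le>k. G j (of_bool (i = 0) + link i x) * link i h ^ j)"
  using dform_chain(1)[of "replicate j h"] assms by (simp add: dpow_def prod_list_replicate map_replicate_const)

text \<open>Of the \<open>p\<close> factors \<open>link i h\<close>, all but two are bounded by
  \<open>sqrt 2\<close>. The remaining two are summed over the chain by
  \<open>sum_link_sq_le\<close>, which keeps the bound independent of \<open>k\<close>.\<close>

lemma dpow_dist_chain_le:
  "dpow_dist chain p x y \<le> L * 2 powr ((real p + \<nu>) / 2 + 1) * norm (x - y) powr \<nu>"
  unfolding dpow_dist_def
proof (rule cSUP_least)
  show "cball 0 1 \<noteq> ({} :: 'a set)" by simp
  fix h :: 'a
  assume "h \<in> cball 0 1"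
  then have h: "norm h \<le> 1" by simp
  let ?D = "L * (sqrt 2 * norm (x - y)) powr \<nu>"
  have pow: "\<bar>link i h\<bar> ^ p \<le> sqrt 2 ^ (p - 2) * (link i h)\<^sup>2" for i
  proof -
    have "\<bar>link i h\<bar> \<le> sqrt 2"
      by (rule order_trans[OF link_le]) (use h in simp)
    then have "\<bar>link i h\<bar> ^ (p - 2) * (link i h)\<^sup>2 \<le> sqrt 2 ^ (p - 2) * (link i h)\<^sup>2"
      by (intro mult_right_mono power_mono) auto
    moreover have "\<bar>link i h\<bar> ^ p = \<bar>link i h\<bar> ^ (p - 2) * (link i h)\<^sup>2"
      using p_ge_2 by (metis le_add_diff_inverse2 power2_abs power_add)
    ultimately show ?thesis by simp
  qed
  have diff: "\<bar>G p (of_bool (i = 0) + link i x) - G p (of_bool (i = 0) + link i y)\<bar> \<le> ?D" for i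
  proof -
    have "\<bar>link i x - link i y\<bar> powr \<nu> \<le> (sqrt 2 * norm (x - y)) powr \<nu>"
      using link_le[of i "x - y"] \<nu>_nonneg by (intro powr_mono2) (auto simp: link_diff)
    then show ?thesis
      using hoelder[of "of_bool (i = 0) + link i x" "of_bool (i = 0) + link i y"] L_nonneg
      by (smt (verit) mult_left_mono add_diff_cancel_left)
  qed
  have D: "0 \<le> ?D" using L_nonneg by simp
  have "\<bar>dpow chain p x h - dpow chain p y h\<bar> = \<bar>\<Sum>i\<le>k.
      (G p (of_bool (i = 0) + link i x) - G p (of_bool (i = 0) + link i y)) * link i h ^ p\<bar>"
    by (simp add: dpow_chain sum_subtractf left_diff_distrib)
  also have "\<dots> \<le> (\<Sum>i\<le>k.
      \<bar>G p (of_bool (i = 0) + link i x) - G p (of_bool (i = 0) + link i y)\<bar> * \<bar>link i h\<bar> ^ p)"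
    by (rule order_trans[OF sum_abs]) (simp add: abs_mult power_abs)
  also have "\<dots> \<le> (\<Sum>i\<le>k. ?D * (sqrt 2 ^ (p - 2) * (link i h)\<^sup>2))"
    using D by (intro sum_mono mult_mono diff pow) auto
  also have "\<dots> = ?D * sqrt 2 ^ (p - 2) * (\<Sum>i\<le>k. (link i h)\<^sup>2)"
    by (simp add: sum_distrib_left mult_ac)
  also have "\<dots> \<le> ?D * sqrt 2 ^ (p - 2) * 4"
  proof (rule mult_left_mono)
    have "(norm h)\<^sup>2 \<le> 1" using h by (simp add: power_le_one)
    then show "(\<Sum>i\<le>k. (link i h)\<^sup>2) \<le> 4" using sum_link_sq_le[of h] by linarith
  qed (use D in simp)
  \<comment> \<open>The exponents \<open>\<nu> / 2\<close> from the increment,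
    \<open>(p - 2) / 2\<close> from the bounded factors and 2 from the sum of squares are
    collected.\<close>
  also have "\<dots> = L * 2 powr ((real p + \<nu>) / 2 + 1) * norm (x - y) powr \<nu>"
  proof -
    have "sqrt 2 ^ (p - 2) = 2 powr ((real p - 2) / 2)"
      using p_ge_2 by (simp add: powr_half_sqrt[symmetric] powr_powr of_nat_diff flip: powr_realpow)
    moreover have "(4::real) = 2 powr 2" by simp
    moreover have "(sqrt 2 * norm (x - y)) powr \<nu> = 2 powr (\<nu> / 2) * norm (x - y) powr \<nu>"
      by (simp add: powr_mult powr_half_sqrt[symmetric] powr_powr)
    moreover have "2 powr (\<nu> / 2) * 2 powr ((real p - 2) / 2) * 2 powr 2
        = (2::real) powr ((real p + \<nu>) / 2 + 1)"
      unfolding powr_add[symmetric] by (rule arg_cong[where f="(powr) 2"]) (simp add: field_simps)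
    ultimately show ?thesis by (simp add: mult_ac)
  qed
  finally show "\<bar>dpow chain p x h - dpow chain p y h\<bar>
      \<le> L * 2 powr ((real p + \<nu>) / 2 + 1) * norm (x - y) powr \<nu>" .
qed

lemma holder_const_chain_le:
  "holder_const chain p \<nu> \<le> ennreal (L * 2 powr ((real p + \<nu>) / 2 + 1))"
  unfolding holder_const_def
proof (rule SUP_least, clarify)
  fix x y :: 'a
  assume "x \<noteq> y"
  then show "ennreal (dpow_dist chain p x y / norm (x - y) powr \<nu>)
      \<le> ennreal (L * 2 powr ((real p + \<nu>) / 2 + 1))"
    using dpow_dist_chain_le[of x y] by (intro ennreal_leI) (simp add: divide_le_eq)
qed

section \<open>Convexity and minimum of the chain\<close>

lemma convex_chain: "convex_on UNIV chain"
proof (rule convex_onI)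
  fix t :: real and x y :: 'a
  assume t: "0 < t" "t < 1"
  have "of_bool (i = 0) + link i ((1 - t) *\<^sub>R x + t *\<^sub>R y)
      = (1 - t) * (of_bool (i = 0) + link i x) + t * (of_bool (i = 0) + link i y)" for i
    by (simp only: link_add link_scaleR) (simp add: algebra_simps)
  then have "G 0 (of_bool (i = 0) + link i ((1 - t) *\<^sub>R x + t *\<^sub>R y))
      \<le> (1 - t) * G 0 (of_bool (i = 0) + link i x) + t * G 0 (of_bool (i = 0) + link i y)" for i
    using convex_onD[OF convex_profile, of t "of_bool (i = 0) + link i x" "of_bool (i = 0) + link i y"] t
    by simp
  then show "chain ((1 - t) *\<^sub>R x + t *\<^sub>R y) \<le> (1 - t) * chain x + t * chain y"
    unfolding chain_def sum_distrib_left sum.distrib[symmetric] by (intro sum_mono)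
qed simp

text \<open>When coordinate \<open>T\<close> vanishes, the first \<open>T\<close> links already
  descend from 1 to 0, and the others are nonnegative. The case \<open>T = t + 1\<close> serves the
  test points; \<open>T = Suc k\<close> holds for every \<open>x\<close> and gives the
  minimum.\<close>

lemma chain_ge:
  assumes "T \<le> Suc k" "0 < T" "x \<bullet> b T = 0"
  shows "real T * G 0 (1 / real T) \<le> chain x"
proof -
  have "real T * G 0 (1 / real T) \<le> (\<Sum>i<T. G 0 (coord x i - coord x (Suc i)))"
    using assms by (intro jensen_telescope) (auto simp: coord_def b_0)
  also have "\<dots> \<le> (\<Sum>i\<le>k. G 0 (coord x i - coord x (Suc i)))"
    using assms nonneg by (intro sum_mono2) auto
  finally show ?thesis by (simp add: chain_def coord_diff)
qed

lemma minimizer_coord: "i \<le> Suc k \<Longrightarrow> coord minimizer i = 1 - real i / real (Suc k)"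
proof -
  assume "i \<le> Suc k"
  have "minimizer \<bullet> b i
      = (\<Sum>j=1..k. if j = i then 1 - real j / real (Suc k) else 0)"
    unfolding minimizer_def inner_sum_left by (intro sum.cong) (auto simp: b_inner)
  then show ?thesis
    using \<open>i \<le> Suc k\<close> by (auto simp: coord_def le_Suc_eq)
qed

lemma chain_minimizer: "chain minimizer = real (Suc k) * G 0 (1 / real (Suc k))"
proof -
  have "coord minimizer i - coord minimizer (Suc i) = 1 / real (Suc k)" if "i \<le> k" for i
    using that minimizer_coord[of i] minimizer_coord[of "Suc i"]
    by (simp flip: diff_divide_distrib)
  then show ?thesis
    unfolding chain_def coord_diff by simp
qed

lemma global_minimizer_chain: "global_minimizer chain minimizer"
  unfolding global_minimizer_def chain_minimizer
  using chain_ge[of "Suc k"] b_beyond by simp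

text \<open>The squared norm is exactly \<open>k (2k + 1) / (6 (k + 1))\<close>.\<close>

lemma norm_minimizer_le: "(norm minimizer)\<^sup>2 \<le> real (Suc k) / 3"
proof -
  have "(norm minimizer)\<^sup>2 = (\<Sum>i=1..k. (1 - real i / real (Suc k)) * (minimizer \<bullet> b i))"
    unfolding power2_norm_eq_inner by (subst (2) minimizer_def) (simp add: inner_sum_right)
  also have "\<dots> = (\<Sum>i=1..k. (1 - real i / real (Suc k))\<^sup>2)"
  proof (rule sum.cong)
    fix i assume "i \<in> {1..k}"
    then show "(1 - real i / real (Suc k)) * (minimizer \<bullet> b i) = (1 - real i / real (Suc k))\<^sup>2"
      using minimizer_coord[of i] by (simp add: coord_def power2_eq_square)
  qed simp
  also have "\<dots> = (\<Sum>i=1..k. (real (Suc k - i))\<^sup>2) / (real (Suc k))\<^sup>2"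
    unfolding sum_divide_distrib
    by (intro sum.cong) (auto simp: of_nat_diff power_divide[symmetric] diff_divide_distrib)
  also have "(\<Sum>i=1..k. (real (Suc k - i))\<^sup>2) = (\<Sum>i=1..k. (real i)\<^sup>2)"
    by (rule sum.reindex_bij_witness[of _ "\<lambda>i. Suc k - i" "\<lambda>i. Suc k - i"]) auto
  also have "(\<Sum>i=1..k. (real i)\<^sup>2) = real k * (real k + 1) * (2 * real k + 1) / 6"
    by (induction k) (auto simp: field_simps power2_eq_square)
  also have "\<dots> / (real (Suc k))\<^sup>2 \<le> real (Suc k) / 3"
    by (simp add: divide_simps power2_eq_square) (simp add: algebra_simps)
  finally show ?thesis .
qed

lemma admissible_chain: "admissible_objective p \<nu> chain"
  unfolding admissible_objective_def
  using convex_chain times_differentiable_chain global_minimizer_chain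
    order_le_less_trans[OF holder_const_chain_le ennreal_less_top] by auto

section \<open>Coordinates reachable by the method\<close>

text \<open>The links beyond \<open>i\<close> have argument 0 at \<open>x\<close>, where all
  derivatives of the profile vanish, so the polynomial part of the model is constant along
  \<open>b j\<close>. Stationarity along \<open>b j\<close> then concerns the regularizer alone,
  whose slope there is a positive multiple of \<open>h \<bullet> b j\<close>. Link \<open>i\<close>
  does involve \<open>b (Suc i)\<close>, hence the gap of one index.\<close>

lemma stationary_point_inner:
  assumes x: "\<And>j. i < j \<Longrightarrow> x \<bullet> b j = 0"
    and "0 < \<gamma>" "1 < m"
    and h: "h \<in> stationary_points p chain x a \<gamma> m"
    and "Suc i < j"
  shows "h \<bullet> b j = 0"
proof (cases "h = 0")
  case False
  define Q where "Q y = (\<Sum>r=1..p. a r * dpow chain r x y)" for y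
  have "G r (of_bool (l = 0) + link l x) * link l (h + s *\<^sub>R b j) ^ r
      = G r (of_bool (l = 0) + link l x) * link l h ^ r" if "r \<le> p" for r l s
  proof (cases "l \<le> i")
    case True
    then have "link l (h + s *\<^sub>R b j) = link l h"
      using \<open>Suc i < j\<close> by (simp add: link_add link_scaleR link_eq[of l "b j"] b_inner)
    then show ?thesis by simp
  next
    case False
    \<comment> \<open>As \<open>l > i\<close>, the anchor term is absent and both coordinates in the
      link are 0.\<close>
    then have "of_bool (l = 0) + link l x = 0"
      using x by (simp add: link_eq)
    then show ?thesis using vanish_at_0 that by simp
  qed
  then have Q: "Q (h + s *\<^sub>R b j) = Q h" for s
    unfolding Q_def
    by (intro sum.cong) (simp_all only: dpow_chain atLeastAtMost_iff cong: sum.cong)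
  \<comment> \<open>The squared norm along the line is a polynomial in \<open>s\<close>, positive at
    \<open>s = 0\<close> because \<open>h \<noteq> 0\<close>; its power \<open>m / 2\<close> is
    therefore differentiable there.\<close>
  define E where "E s = (h + s *\<^sub>R b j) \<bullet> (h + s *\<^sub>R b j)" for s
  have E: "reg_model p chain x a \<gamma> m (h + s *\<^sub>R b j) = Q h + \<gamma> * E s powr (m / 2)" for s
    using Q[of s] by (simp add: reg_model_def Q_def E_def norm_eq_sqrt_inner powr_half_sqrt[symmetric] powr_powr)
  have "((\<lambda>s. reg_model p chain x a \<gamma> m (h + s *\<^sub>R b j)) has_derivative (\<lambda>_. 0)) (at 0)"
  proof (rule has_derivative_compose[of "\<lambda>s. h + s *\<^sub>R b j" "\<lambda>s. s *\<^sub>R b j" 0 UNIV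
        "reg_model p chain x a \<gamma> m" "\<lambda>_. 0", simplified])
    show "((\<lambda>s. h + s *\<^sub>R b j) has_derivative (\<lambda>s. s *\<^sub>R b j)) (at 0)"
      by (auto intro!: derivative_eq_intros)
    show "(reg_model p chain x a \<gamma> m has_derivative (\<lambda>_. 0)) (at h)"
      using h by (simp add: stationary_points_def)
  qed
  then have "((\<lambda>s. Q h + \<gamma> * E s powr (m / 2)) has_real_derivative 0) (at 0)"
    by (simp add: E has_field_derivative_def lambda_zero)
  moreover have "((\<lambda>s. Q h + \<gamma> * E s powr (m / 2)) has_real_derivative
      \<gamma> * (m / 2 * E 0 powr (m / 2 - 1) * (2 * (h \<bullet> b j)))) (at 0)"
  proof -
    have "E = (\<lambda>s. h \<bullet> h + 2 * s * (h \<bullet> b j) + s\<^sup>2 * (b j \<bullet> b j))"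
      by (simp add: fun_eq_iff E_def inner_add_left inner_add_right inner_commute power2_eq_square)
    then have "(E has_real_derivative 2 * (h \<bullet> b j)) (at 0)"
      by (auto intro!: derivative_eq_intros)
    moreover have "E 0 > 0" using False by (simp add: E_def)
    ultimately have "((\<lambda>s. E s powr (m / 2)) has_real_derivative
        m / 2 * E 0 powr (m / 2 - 1) * (2 * (h \<bullet> b j))) (at 0)"
      using DERIV_fun_powr[of E "2 * (h \<bullet> b j)" 0 "m / 2"] by simp
    then show ?thesis
      using DERIV_add[OF DERIV_const DERIV_cmult] by fastforce
  qed
  ultimately have "\<gamma> * (m / 2 * E 0 powr (m / 2 - 1) * (2 * (h \<bullet> b j))) = 0"
    by (rule DERIV_unique[symmetric])
  moreover have "E 0 \<noteq> 0" using False by (simp add: E_def)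
  ultimately show ?thesis using \<open>0 < \<gamma>\<close> \<open>1 < m\<close> by simp
qed simp

text \<open>Orthogonality to \<open>b j\<close> is a linear condition, so it passes from the
  stationary points to their span.\<close>

lemma step_space_inner:
  assumes "\<And>j. i < j \<Longrightarrow> x \<bullet> b j = 0" "h \<in> step_space p chain x" "Suc i < j"
  shows "h \<bullet> b j = 0"
proof -
  have "step_space p chain x \<subseteq> {h. b j \<bullet> h = 0}"
    unfolding step_space_def
    using stationary_point_inner[OF assms(1) _ _ _ assms(3)]
    by (intro span_minimal subspace_hyperplane) (auto simp: inner_commute)
  then show ?thesis
    using assms(2) by (auto simp: inner_commute)
qed

text \<open>A step taken from \<open>x l\<close> activates coordinates up to \<open>Suc l\<close>
  only, and \<open>x (Suc r)\<close> combines steps from \<open>x 0\<close> to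
  \<open>x r\<close>.\<close>

lemma tensor_steps_inner:
  assumes steps: "tensor_steps p chain x" and "x 0 = 0" and "i < j"
  shows "x i \<bullet> b j = 0"
  using \<open>i < j\<close>
proof (induction i arbitrary: j rule: less_induct)
  case (less i)
  show ?case
  proof (cases i)
    case 0
    then show ?thesis using \<open>x 0 = 0\<close> by simp
  next
    case (Suc r)
    obtain s where s: "\<And>l. l \<le> r \<Longrightarrow> s l \<in> step_space p chain (x l)"
        and x: "x (Suc r) = x 0 + (\<Sum>l\<le>r. s l)"
      using steps unfolding tensor_steps_def by blast
    have "s l \<bullet> b j = 0" if "l \<le> r" for l
      using that less.prems Suc by (intro step_space_inner[OF less.IH s]) auto
    then show ?thesis
      using Suc x \<open>x 0 = 0\<close> by (simp add: inner_sum_left)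
  qed
qed

text \<open>Coordinate \<open>t + 1\<close> is 0 at all test points up to \<open>t\<close>, so
  \<open>chain_ge\<close> bounds the left side of the rate from below, while the Hoelder constant
  and the norm of \<open>minimizer\<close> bound its right side from above.\<close>

lemma gap_le:
  assumes steps: "tensor_steps p chain x" and x0: "x 0 = 0" and "t \<le> k"
    and pos: "0 < c"
    and rate: "Min ((\<lambda>i. chain (x i)) ` {0..t}) - chain minimizer
      \<le> enn2real (holder_const chain p \<nu>) * norm (x 0 - minimizer) powr (real p + \<nu>) / c"
  shows "c * (real (Suc t) * G 0 (1 / real (Suc t)) - real (Suc k) * G 0 (1 / real (Suc k)))
    \<le> L * 2 powr ((real p + \<nu>) / 2 + 1) * (real (Suc k) / 3) powr ((real p + \<nu>) / 2)"
proof -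
  have "real (Suc t) * G 0 (1 / real (Suc t)) \<le> Min ((\<lambda>i. chain (x i)) ` {0..t})"
    using chain_ge[of "Suc t"] tensor_steps_inner[OF steps x0] \<open>t \<le> k\<close>
    by (auto simp: Min_ge_iff)
  moreover have "enn2real (holder_const chain p \<nu>) \<le> L * 2 powr ((real p + \<nu>) / 2 + 1)"
    using L_nonneg by (intro enn2real_leI holder_const_chain_le) auto
  moreover have "norm (x 0 - minimizer) powr (real p + \<nu>)
      \<le> (real (Suc k) / 3) powr ((real p + \<nu>) / 2)"
  proof -
    have powr_sq: "r powr s = r\<^sup>2 powr (s / 2)" if "0 \<le> r" for r s :: real
      using that by (cases "r = 0") (simp_all add: powr_powr flip: powr_numeral)
    have "norm minimizer powr (real p + \<nu>) = ((norm minimizer)\<^sup>2) powr ((real p + \<nu>) / 2)"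
      by (rule powr_sq) simp
    also have "\<dots> \<le> (real (Suc k) / 3) powr ((real p + \<nu>) / 2)"
      using \<nu>_nonneg by (intro powr_mono2 norm_minimizer_le) auto
    finally show ?thesis using x0 by simp
  qed
  then have "enn2real (holder_const chain p \<nu>) * norm (x 0 - minimizer) powr (real p + \<nu>)
      \<le> L * 2 powr ((real p + \<nu>) / 2 + 1) * (real (Suc k) / 3) powr ((real p + \<nu>) / 2)"
    using calculation L_nonneg by (intro mult_mono) auto
  ultimately have "real (Suc t) * G 0 (1 / real (Suc t)) - real (Suc k) * G 0 (1 / real (Suc k))
      \<le> L * 2 powr ((real p + \<nu>) / 2 + 1) * (real (Suc k) / 3) powr ((real p + \<nu>) / 2) / c"
    using rate pos unfolding chain_minimizer
    by (smt (verit, best) divide_right_mono)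
  then show ?thesis
    using pos by (simp add: field_simps)
qed

end

section \<open>Power profiles\<close>

definition pos_powr :: "real \<Rightarrow> real \<Rightarrow> real" where
  "pos_powr r \<tau> = max 0 \<tau> powr r"

text \<open>Only the point 0 needs an argument: the difference quotient there is at most
  \<open>\<bar>h\<bar> powr (r - 1)\<close>, which tends to 0 since \<open>r > 1\<close>.\<close>

lemma pos_powr_has_derivative:
  assumes "1 < r"
  shows "(pos_powr r has_real_derivative r * pos_powr (r - 1) \<tau>) (at \<tau>)"
proof -
  consider "\<tau> > 0" | "\<tau> < 0" | "\<tau> = 0" by linarith
  then show ?thesis
  proof cases
    case 1
    have "((\<lambda>\<tau>. \<tau> powr r) has_real_derivative r * pos_powr (r - 1) \<tau>) (at \<tau>)"
      using has_real_derivative_powr[OF 1, of r] 1 by (simp add: pos_powr_def)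
    then show ?thesis
      by (rule has_field_derivative_transform_within_open[where S="{0<..}"])
        (use 1 in \<open>auto simp: pos_powr_def\<close>)
  next
    case 2
    have "((\<lambda>\<tau>. 0) has_real_derivative r * pos_powr (r - 1) \<tau>) (at \<tau>)"
      using 2 by (simp add: pos_powr_def)
    then show ?thesis
      by (rule has_field_derivative_transform_within_open[where S="{..<0}"])
        (use 2 in \<open>auto simp: pos_powr_def\<close>)
  next
    case 3
    have "((\<lambda>h. pos_powr r h / h) \<longlongrightarrow> 0) (at 0)"
    proof (rule Lim_null_comparison)
      show "\<forall>\<^sub>F h in at 0. norm (pos_powr r h / h) \<le> \<bar>h\<bar> powr (r - 1)"
        unfolding eventually_at_filter
        by (rule always_eventually) (auto simp: pos_powr_def max_def powr_diff intro: divide_nonneg_neg)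
      show "((\<lambda>h::real. \<bar>h\<bar> powr (r - 1)) \<longlongrightarrow> 0) (at 0)"
        by (rule tendsto_zero_powrI[where b="r - 1"])
          (use assms in \<open>auto intro!: tendsto_eq_intros\<close>)
    qed
    then show ?thesis
      using 3 assms by (simp add: DERIV_def pos_powr_def)
  qed
qed

text \<open>Subadditivity of the power: \<open>u \<le> u powr \<nu>\<close> on the unit interval,
  applied to \<open>y / x\<close> and \<open>(x - y) / x\<close>, which sum to 1.\<close>

lemma powr_diff_le_powr:
  fixes x y \<nu> :: real
  assumes "0 \<le> y" "y \<le> x" "0 < \<nu>" "\<nu> \<le> 1"
  shows "x powr \<nu> - y powr \<nu> \<le> (x - y) powr \<nu>"
proof (cases "x = 0")
  case False
  then have "0 < x" using assms by linarith
  have le: "u \<le> u powr \<nu>" if "0 \<le> u" "u \<le> 1" for u :: real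
    using powr_mono'[of \<nu> 1 u] that assms by simp
  have "1 \<le> (y / x) powr \<nu> + ((x - y) / x) powr \<nu>"
    using le[of "y / x"] le[of "(x - y) / x"] \<open>0 < x\<close> assms by (simp add: diff_divide_distrib)
  also have "\<dots> = (y powr \<nu> + (x - y) powr \<nu>) / x powr \<nu>"
    using \<open>0 < x\<close> assms by (simp add: powr_divide add_divide_distrib)
  finally show ?thesis
    using \<open>0 < x\<close> by (simp add: le_divide_eq)
qed (use assms in simp)

lemma pos_powr_hoelder:
  assumes "0 < \<nu>" "\<nu> \<le> 1"
  shows "\<bar>pos_powr \<nu> a - pos_powr \<nu> c\<bar> \<le> \<bar>a - c\<bar> powr \<nu>"
proof -
  have *: "pos_powr \<nu> a - pos_powr \<nu> c \<le> \<bar>a - c\<bar> powr \<nu>"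
    and **: "pos_powr \<nu> c \<le> pos_powr \<nu> a" if "c \<le> a" for a c
  proof -
    have "pos_powr \<nu> a - pos_powr \<nu> c \<le> (max 0 a - max 0 c) powr \<nu>"
      unfolding pos_powr_def using that assms by (intro powr_diff_le_powr) auto
    also have "\<dots> \<le> \<bar>a - c\<bar> powr \<nu>"
      using that assms by (intro powr_mono2) auto
    finally show "pos_powr \<nu> a - pos_powr \<nu> c \<le> \<bar>a - c\<bar> powr \<nu>" .
    show "pos_powr \<nu> c \<le> pos_powr \<nu> a"
      unfolding pos_powr_def using that assms by (intro powr_mono2) auto
  qed
  show ?thesis
    using *[of c a] **[of c a] *[of a c] **[of a c] by (cases "c \<le> a") (auto simp: abs_minus_commute)
qed

definition falling :: "nat \<Rightarrow> real \<Rightarrow> real" where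
  "falling j q = (\<Prod>i<j. q - real i)"

text \<open>For \<open>j < q\<close> this is the \<open>j\<close>-th derivative of
  \<open>max(\<tau>, 0)^q / q\<close>.\<close>

definition power_profile :: "real \<Rightarrow> nat \<Rightarrow> real \<Rightarrow> real" where
  "power_profile q j \<tau> = falling j q / q * pos_powr (q - real j) \<tau>"

lemma falling_nonneg: "real j \<le> q + 1 \<Longrightarrow> 0 \<le> falling j q"
  unfolding falling_def by (intro prod_nonneg) auto

lemma power_profile_has_derivative:
  assumes "real j + 1 < q"
  shows "(power_profile q j has_real_derivative power_profile q (Suc j) \<tau>) (at \<tau>)"
proof -
  have "(power_profile q j has_real_derivative
      falling j q / q * ((q - real j) * pos_powr (q - real j - 1) \<tau>)) (at \<tau>)"
    unfolding power_profile_def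
    using assms by (intro DERIV_cmult pos_powr_has_derivative) simp
  moreover have "falling j q / q * ((q - real j) * pos_powr (q - real j - 1) \<tau>)
      = power_profile q (Suc j) \<tau>"
    by (simp add: power_profile_def falling_def diff_diff_eq add.commute)
  ultimately show ?thesis by simp
qed

lemma smooth_profile_power:
  assumes "2 \<le> p" "0 < \<nu>" "\<nu> \<le> 1"
  shows "smooth_profile (power_profile (real p + \<nu>)) p \<nu> (falling p (real p + \<nu>) / (real p + \<nu>))"
proof
  show "\<bar>power_profile (real p + \<nu>) p a - power_profile (real p + \<nu>) p c\<bar>
      \<le> falling p (real p + \<nu>) / (real p + \<nu>) * \<bar>a - c\<bar> powr \<nu>" for a c
  proof -
    let ?F = "falling p (real p + \<nu>) / (real p + \<nu>)"
    have F: "0 \<le> ?F"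
      using assms by (simp add: falling_nonneg)
    have "\<bar>power_profile (real p + \<nu>) p a - power_profile (real p + \<nu>) p c\<bar>
        = \<bar>?F * (pos_powr \<nu> a - pos_powr \<nu> c)\<bar>"
      by (simp add: power_profile_def right_diff_distrib)
    also have "\<dots> = ?F * \<bar>pos_powr \<nu> a - pos_powr \<nu> c\<bar>"
      unfolding abs_mult abs_of_nonneg[OF F] ..
    also have "\<dots> \<le> ?F * \<bar>a - c\<bar> powr \<nu>"
      using F assms by (intro mult_left_mono pos_powr_hoelder)
    finally show ?thesis .
  qed
  \<comment> \<open>Positivity of \<open>\<nu>\<close> enters here: for \<open>j = p - 1\<close> the
    exponent to be differentiated is \<open>1 + \<nu>\<close>, which has to exceed 1.\<close>
  show "(power_profile (real p + \<nu>) j has_real_derivative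
      power_profile (real p + \<nu>) (Suc j) \<tau>) (at \<tau>)" if "j < p" for j \<tau>
    using that assms by (intro power_profile_has_derivative) linarith
  show "0 \<le> power_profile (real p + \<nu>) 0 \<tau>" "0 \<le> power_profile (real p + \<nu>) 2 \<tau>" for \<tau>
    using assms by (auto simp: power_profile_def pos_powr_def intro!: mult_nonneg_nonneg falling_nonneg divide_nonneg_nonneg)
qed (use assms in \<open>auto simp: power_profile_def pos_powr_def\<close>)

section \<open>Smoothed profiles for the exponent \<open>\<nu> = 0\<close>\<close>

text \<open>The difference is taken backwards so that everything still vanishes for
  \<open>\<tau> \<le> 0\<close>. The divisor \<open>real p\<close> is there because the derivative
  of \<open>max(\<tau>, 0)^(p+1) / (p+1)\<close> is \<open>p\<close> times the wanted limit
  \<open>max(\<tau>, 0)^p / p\<close>.\<close>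

definition smoothed_profile :: "nat \<Rightarrow> real \<Rightarrow> nat \<Rightarrow> real \<Rightarrow> real" where
  "smoothed_profile p \<epsilon> j \<tau> =
    (power_profile (real p + 1) j \<tau> - power_profile (real p + 1) j (\<tau> - \<epsilon>)) / (real p * \<epsilon>)"

text \<open>Both sides are the factorial of \<open>p\<close>: without its first factor the left
  product lacks only the factor 1.\<close>

lemma falling_Suc: "falling p (real p + 1) / (real p + 1) = falling p (real p)"
proof (cases p)
  case (Suc r)
  have "falling p (real p + 1) = (real p + 1) * (\<Prod>i<r. real p - real i)"
    unfolding falling_def Suc prod.lessThan_Suc_shift by (simp add: algebra_simps)
  also have "(\<Prod>i<r. real p - real i) = falling p (real p)"
    unfolding falling_def Suc by simp
  finally show ?thesis by simp
qed (simp add: falling_def)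

text \<open>The \<open>p\<close>-th derivative is a ramp that rises from 0 to
  \<open>falling p (real p) / real p\<close> on the interval from 0 to \<open>\<epsilon>\<close>, so
  its oscillation is bounded independently of \<open>\<epsilon>\<close>.\<close>

lemma smooth_profile_smoothed:
  assumes "2 \<le> p" "0 < \<epsilon>"
  shows "smooth_profile (smoothed_profile p \<epsilon>) p 0 (falling p (real p) / real p)"
proof
  have mono: "power_profile (real p + 1) j (\<tau> - \<epsilon>) \<le> power_profile (real p + 1) j \<tau>"
    if "j \<le> p" for j \<tau>
    unfolding power_profile_def pos_powr_def using that assms
    by (intro mult_left_mono powr_mono2 divide_nonneg_nonneg falling_nonneg) auto
  then show "0 \<le> smoothed_profile p \<epsilon> 0 \<tau>" "0 \<le> smoothed_profile p \<epsilon> 2 \<tau>" for \<tau>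
    using assms by (simp_all add: smoothed_profile_def)
  show "(smoothed_profile p \<epsilon> j has_real_derivative smoothed_profile p \<epsilon> (Suc j) \<tau>) (at \<tau>)"
    if "j < p" for j \<tau>
  proof -
    have "(power_profile (real p + 1) j has_real_derivative
        power_profile (real p + 1) (Suc j) \<tau>) (at \<tau>)" for \<tau>
      using that assms by (intro power_profile_has_derivative) linarith
    note D = this
    from D[of "\<tau> + - \<epsilon>"] have "((\<lambda>\<tau>. power_profile (real p + 1) j (\<tau> + - \<epsilon>)) has_real_derivative
        power_profile (real p + 1) (Suc j) (\<tau> + - \<epsilon>)) (at \<tau>)"
      unfolding DERIV_shift .
    with D show ?thesis
      unfolding smoothed_profile_def add_uminus_conv_diff by (intro DERIV_cdivide DERIV_diff)
  qed
  show "\<bar>smoothed_profile p \<epsilon> p a - smoothed_profile p \<epsilon> p c\<bar>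
      \<le> falling p (real p) / real p * \<bar>a - c\<bar> powr 0" for a c
  proof -
    let ?F = "falling p (real p) / real p"
    have F: "0 \<le> ?F" by (simp add: falling_nonneg)
    have "power_profile (real p + 1) p \<tau> = falling p (real p) * max 0 \<tau>" for \<tau>
      unfolding power_profile_def falling_Suc by (simp add: pos_powr_def)
    then have eq: "smoothed_profile p \<epsilon> p \<tau> = ?F * ((max 0 \<tau> - max 0 (\<tau> - \<epsilon>)) / \<epsilon>)" for \<tau>
      by (simp add: smoothed_profile_def flip: right_diff_distrib)
    have "0 \<le> (max 0 \<tau> - max 0 (\<tau> - \<epsilon>)) / \<epsilon>" "(max 0 \<tau> - max 0 (\<tau> - \<epsilon>)) / \<epsilon> \<le> 1" for \<tau>
      using assms by (auto simp: divide_le_eq)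
    then have "0 \<le> smoothed_profile p \<epsilon> p \<tau>" "smoothed_profile p \<epsilon> p \<tau> \<le> ?F" for \<tau>
      unfolding eq using F mult_left_le by (blast intro: mult_nonneg_nonneg)+
    from this[of a] this[of c] have "\<bar>smoothed_profile p \<epsilon> p a - smoothed_profile p \<epsilon> p c\<bar> \<le> ?F"
      by linarith
    \<comment> \<open>The case \<open>a = c\<close> is separate because
      \<open>0 powr 0 = 0\<close>.\<close>
    then show ?thesis by (cases "a = c") simp_all
  qed
qed (use assms in \<open>auto simp: smoothed_profile_def power_profile_def pos_powr_def\<close>)

lemma smoothed_profile_tendsto:
  assumes "2 \<le> p"
  shows "(\<lambda>n. smoothed_profile p (1 / real (Suc n)) 0 \<tau>) \<longlonglongrightarrow> power_profile (real p) 0 \<tau>"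
proof -
  have "(power_profile (real p + 1) 0 has_real_derivative power_profile (real p + 1) 1 \<tau>) (at \<tau>)"
    using power_profile_has_derivative[of 0 "real p + 1"] assms by simp
  then have quotient: "((\<lambda>h. (power_profile (real p + 1) 0 (\<tau> + h) - power_profile (real p + 1) 0 \<tau>) / h)
      \<longlongrightarrow> power_profile (real p + 1) 1 \<tau>) (at 0)"
    by (simp only: DERIV_def)
  \<comment> \<open>Backward differences are difference quotients with negative increments.\<close>
  have "(\<lambda>n. - (1 / real (Suc n))) \<longlonglongrightarrow> - 0"
    by (intro tendsto_minus LIMSEQ_Suc lim_1_over_n)
  then have "filterlim (\<lambda>n. - (1 / real (Suc n))) (at 0) sequentially"
    unfolding filterlim_at by (auto simp del: of_nat_Suc)
  from filterlim_compose[OF quotient this]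
  have "(\<lambda>n. (power_profile (real p + 1) 0 (\<tau> + - (1 / real (Suc n)))
      - power_profile (real p + 1) 0 \<tau>) / (- (1 / real (Suc n))) / real p)
      \<longlonglongrightarrow> power_profile (real p + 1) 1 \<tau> / real p"
    using assms by (intro tendsto_divide tendsto_const) auto
  moreover have "power_profile (real p + 1) 1 \<tau> / real p = power_profile (real p) 0 \<tau>"
    using assms by (simp add: power_profile_def falling_def)
  moreover have "(\<lambda>n. (power_profile (real p + 1) 0 (\<tau> + - (1 / real (Suc n)))
      - power_profile (real p + 1) 0 \<tau>) / (- (1 / real (Suc n))) / real p)
      = (\<lambda>n. smoothed_profile p (1 / real (Suc n)) 0 \<tau>)"
  proof -
    have "(u - v) / - e / real p = (v - u) / (real p * e)" for u v e :: real
      by (metis divide_divide_eq_left minus_diff_eq minus_divide_divide mult.commute)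
    then show ?thesis
      by (simp only: smoothed_profile_def add_uminus_conv_diff)
  qed
  ultimately show ?thesis by simp
qed

section \<open>The rate on a chain\<close>

text \<open>The method is run from the origin on the chain with \<open>k = 2 * t + 1\<close>; the
  dimension bound supplies that many distinct basis vectors.\<close>

lemma smooth_profile_rate:
  fixes M :: "('a::euclidean_space \<Rightarrow> real) \<Rightarrow> 'a \<Rightarrow> nat \<Rightarrow> 'a"
  assumes "smooth_profile G p \<nu> L"
    and meth: "tensor_method p \<nu> M"
    and "0 < c" "1 \<le> t" "2 * t + 1 \<le> DIM('a)"
    and rate: "\<And>f x0 xs. admissible_objective p \<nu> f \<Longrightarrow> global_minimizer f xs \<Longrightarrow>
      Min ((\<lambda>k. f (M f x0 k)) ` {0..t}) - f xs
        \<le> enn2real (holder_const f p \<nu>) * norm (x0 - xs) powr (real p + \<nu>) / c"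
  shows "c * (real (t + 1) * G 0 (1 / real (t + 1)) - real (2 * t + 2) * G 0 (1 / real (2 * t + 2)))
    \<le> L * 2 powr ((real p + \<nu>) / 2 + 1) * (real (2 * t + 2) / 3) powr ((real p + \<nu>) / 2)"
proof -
  interpret smooth_profile G p \<nu> L by fact
  obtain e where e: "bij_betw e {1..DIM('a)} (Basis :: 'a set)"
    using ex_bij_betw_nat_finite_1[OF finite_Basis] by blast
  have *: "chain_instance G p \<nu> L (\<lambda>i. if i \<in> {1..2 * t + 1} then e i else 0) (2 * t + 1)"
  proof
    show "inj_on (\<lambda>i. if i \<in> {1..2 * t + 1} then e i else 0) {1..2 * t + 1}"
      using inj_on_subset[OF bij_betw_imp_inj_on[OF e], of "{1..2 * t + 1}"] assms
      by (auto simp: inj_on_def)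
  qed (use bij_betwE[OF e] assms in auto)
  interpret chain_instance G p \<nu> L "\<lambda>i. if i \<in> {1..2 * t + 1} then e i else 0" "2 * t + 1"
    by (rule *)
  have "M chain 0 0 = 0" "tensor_steps p chain (M chain 0)"
    using meth admissible_chain unfolding tensor_method_def by blast+
  then show ?thesis
    using gap_le[of "M chain 0" t c] rate[OF admissible_chain global_minimizer_chain, of 0] assms
    by simp
qed

text \<open>For \<open>\<nu> = 0\<close> the bounds for the smoothed profiles share one right side,
  and their left sides contain only values of the profile, so pointwise convergence
  suffices.\<close>

lemma power_profile_rate:
  fixes M :: "('a::euclidean_space \<Rightarrow> real) \<Rightarrow> 'a \<Rightarrow> nat \<Rightarrow> 'a"
  assumes "2 \<le> p" "0 \<le> \<nu>" "\<nu> \<le> 1"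
    and asms: "tensor_method p \<nu> M" "0 < c" "1 \<le> t" "2 * t + 1 \<le> DIM('a)"
      "\<And>f x0 xs. admissible_objective p \<nu> f \<Longrightarrow> global_minimizer f xs \<Longrightarrow>
        Min ((\<lambda>k. f (M f x0 k)) ` {0..t}) - f xs
          \<le> enn2real (holder_const f p \<nu>) * norm (x0 - xs) powr (real p + \<nu>) / c"
  defines "q \<equiv> real p + \<nu>" and "g \<equiv> power_profile (real p + \<nu>) 0"
  shows "c * (real (t + 1) * g (1 / real (t + 1)) - real (2 * t + 2) * g (1 / real (2 * t + 2)))
    \<le> falling p q / q * 2 powr (q / 2 + 1) * (real (2 * t + 2) / 3) powr (q / 2)"
proof (cases "\<nu> = 0")
  case False
  then have "smooth_profile (power_profile q) p \<nu> (falling p q / q)"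
    unfolding q_def using assms(1-3) by (intro smooth_profile_power) auto
  from smooth_profile_rate[OF this asms] show ?thesis
    by (simp add: q_def g_def)
next
  case True
  let ?g = "\<lambda>n. smoothed_profile p (1 / real (Suc n)) 0"
  have "c * (real (t + 1) * ?g n (1 / real (t + 1)) - real (2 * t + 2) * ?g n (1 / real (2 * t + 2)))
    \<le> falling p q / q * 2 powr (q / 2 + 1) * (real (2 * t + 2) / 3) powr (q / 2)" for n
  proof -
    have "smooth_profile (smoothed_profile p (1 / real (Suc n))) p \<nu> (falling p q / q)"
      using smooth_profile_smoothed[OF \<open>2 \<le> p\<close>, of "1 / real (Suc n)"] True
      by (simp add: q_def del: of_nat_Suc)
    from smooth_profile_rate[OF this asms] show ?thesis
      by (simp only: q_def)
  qed
  moreover have "(\<lambda>n. c * (real (t + 1) * ?g n (1 / real (t + 1))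
        - real (2 * t + 2) * ?g n (1 / real (2 * t + 2))))
      \<longlonglongrightarrow> c * (real (t + 1) * g (1 / real (t + 1)) - real (2 * t + 2) * g (1 / real (2 * t + 2)))"
    unfolding g_def True add_0_right by (intro tendsto_intros smoothed_profile_tendsto \<open>2 \<le> p\<close>)
  ultimately show ?thesis
    using LIMSEQ_le_const2 by blast
qed

section \<open>The constant\<close>

lemma sq_le_two_power: "4 \<le> n \<Longrightarrow> n\<^sup>2 \<le> (2::nat) ^ n"
proof (induction n rule: dec_induct)
  case (step n)
  have "4 * n \<le> n * n"
    using step.hyps by (intro mult_right_mono) auto
  moreover have "(Suc n)\<^sup>2 = n * n + 2 * n + 1"
    by (simp add: power2_eq_square)
  ultimately have "(Suc n)\<^sup>2 \<le> 2 * n\<^sup>2"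
    using step.hyps unfolding power2_eq_square by linarith
  then show ?case
    using step.IH unfolding power_Suc by linarith
qed simp

text \<open>With \<open>A = 2^(p/2)\<close> this is the case \<open>\<nu> = 0\<close> of
  \<open>exponent_bound\<close>. It is an equality for \<open>p = 2\<close>; from
  \<open>p = 4\<close> on, \<open>p \<le> A\<close> is enough.\<close>

lemma exponent_bound_hoelder_0:
  fixes A :: real
  assumes p: "2 \<le> p" and A: "0 < A" "A\<^sup>2 = 2 ^ p"
  shows "real p - 1 \<le> A - 2 / A"
proof -
  consider "p = 2" | "p = 3" | "4 \<le> p" using p by linarith
  then show ?thesis
  proof cases
    case 1
    then have "A\<^sup>2 = 2\<^sup>2" using A(2) by simp
    then have "A = 2" by (rule power2_eq_imp_eq) (use A(1) in auto)
    then show ?thesis using 1 by simp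
  next
    case 2
    then have "A * A = 8" using A(2) by (simp add: power2_eq_square)
    \<comment> \<open>A rational lower bound for the square root of 8, sharp enough since
      \<open>14/5 - 5/7 > 2\<close>.\<close>
    then have "(14 / 5)\<^sup>2 \<le> A\<^sup>2"
      by (simp add: power2_eq_square)
    then have "14 / 5 \<le> A"
      by (rule power2_le_imp_le) (use A(1) in simp)
    moreover from this have "2 / A \<le> 2 / (14 / 5)"
      by (intro divide_left_mono) auto
    ultimately show ?thesis using 2 by simp
  next
    case 3
    have "real (p\<^sup>2) \<le> real (2 ^ p)"
      using sq_le_two_power[OF 3] by (simp only: of_nat_le_iff)
    then have "(real p)\<^sup>2 \<le> A\<^sup>2"
      unfolding A(2) by simp
    then have "real p \<le> A"
      by (rule power2_le_imp_le) (use A(1) in simp)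
    moreover from this have "2 / A \<le> 1" using 3 A(1) by (simp add: divide_le_eq)
    ultimately show ?thesis by linarith
  qed
qed

text \<open>The right side is \<open>A * 2 powr \<nu> - 2 / A\<close> with
  \<open>A = 2^(p/2)\<close>. Passing from 0 to \<open>\<nu>\<close> adds \<open>\<nu>\<close> on
  the left and at least \<open>A * \<nu> / 2\<close> on the right, and
  \<open>A \<ge> 2\<close>.\<close>

lemma exponent_bound:
  assumes "2 \<le> p" "0 \<le> \<nu>"
  shows "real p + \<nu> - 1 \<le> 2 powr (real p / 2 + \<nu>) * (1 - 2 powr (1 - (real p + \<nu>)))"
proof -
  define A :: real where "A = 2 powr (real p / 2)"
  have A: "0 < A" "A\<^sup>2 = 2 ^ p"
    unfolding A_def by (simp_all only: powr_power powr_realpow[symmetric]) simp_all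
  have "2\<^sup>2 \<le> A\<^sup>2"
    unfolding A(2) using assms by (intro power_increasing) auto
  then have "2 \<le> A"
    by (rule power2_le_imp_le) (use A(1) in simp)
  have "1 + \<nu> * ln 2 \<le> 2 powr \<nu>"
    using exp_ge_add_one_self[of "\<nu> * ln 2"] by (simp add: powr_def)
  moreover have "\<nu> / 2 \<le> \<nu> * ln 2"
    using ln2_ge_two_thirds mult_left_mono[of "1 / 2" "ln 2" \<nu>] assms by simp
  ultimately have "A * (1 + \<nu> / 2) \<le> A * 2 powr \<nu>"
    using A by (intro mult_left_mono) auto
  moreover have "\<nu> \<le> A * (\<nu> / 2)"
    using \<open>2 \<le> A\<close> mult_right_mono[of 2 A "\<nu> / 2"] assms by simp
  ultimately have "real p + \<nu> - 1 \<le> A * 2 powr \<nu> - 2 / A"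
    using exponent_bound_hoelder_0[OF assms(1) A] by (simp add: distrib_left)
  also have "2 / A = 2 powr (real p / 2 + \<nu>) * 2 powr (1 - (real p + \<nu>))"
  proof -
    have "2 powr (real p / 2 + \<nu>) * 2 powr (1 - (real p + \<nu>)) = (2::real) powr (1 - real p / 2)"
      unfolding powr_add[symmetric] by (rule arg_cong[where f="(powr) 2"]) (simp add: field_simps)
    then show ?thesis
      by (simp add: A_def powr_diff)
  qed
  finally show ?thesis
    by (simp add: A_def powr_add right_diff_distrib)
qed

theorem theorem5p5:
  fixes p :: nat and \<nu> :: real
    and M :: "(real ^ 'n \<Rightarrow> real) \<Rightarrow> real ^ 'n \<Rightarrow> nat \<Rightarrow> real ^ 'n"
    and \<kappa> :: "nat \<Rightarrow> real"
  assumes "p \<ge> 2" and "0 \<le> \<nu>" and "\<nu> \<le> 1"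
    and meth: "tensor_method p \<nu> M"
    and kappa_pos: "\<And>t. t \<ge> 1 \<Longrightarrow> \<kappa> t > 0"
    and rate: "\<And>f x0 xs t. admissible_objective p \<nu> f \<Longrightarrow> global_minimizer f xs \<Longrightarrow> t \<ge> 1 \<Longrightarrow>
      Min ((\<lambda>k. f (M f x0 k)) ` {0..t}) - f xs
        \<le> enn2real (holder_const f p \<nu>) * norm (x0 - xs) powr (real p + \<nu>) / \<kappa> t"
  shows "\<forall>t\<ge>1. 2 * t + 1 \<le> CARD('n) \<longrightarrow>
    \<kappa> t \<le> rate_const p \<nu> * real (t + 1) powr ((3 * (real p + \<nu>) - 2) / 2)"
proof (intro allI impI)
  fix t :: nat
  assume t: "1 \<le> t" "2 * t + 1 \<le> CARD('n)"
  define q where "q = real p + \<nu>"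
  define T where "T = real (t + 1)"
  \<comment> \<open>\<open>D\<close> is the relative gap between the Jensen bounds for
    \<open>T\<close> and for \<open>2 * T\<close> links, since \<open>(2 * T) powr (1 - q)\<close>
    is \<open>2 powr (1 - q)\<close> times \<open>T powr (1 - q)\<close>.\<close>
  define D where "D = 1 - 2 powr (1 - q)"
  define P where "P = falling p q"
  have q: "2 \<le> q" and T: "0 < T" using assms by (simp_all add: q_def T_def)
  have D: "0 < D"
    using q powr_less_mono[of "1 - q" 0 2] by (simp add: D_def)
  have P: "0 \<le> P" using assms by (simp add: P_def q_def falling_nonneg)
  have gap: "\<tau> * power_profile q 0 (1 / \<tau>) = \<tau> powr (1 - q) / q" if "0 < \<tau>" for \<tau>
    using that by (simp add: power_profile_def falling_def pos_powr_def powr_divide powr_diff)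
  have K: "real (2 * t + 2) = 2 * T" by (simp add: T_def)
  have dim: "2 * t + 1 \<le> DIM(real ^ 'n)" using t(2) by simp
  have "\<kappa> t * (T * power_profile q 0 (1 / T) - 2 * T * power_profile q 0 (1 / (2 * T)))
      \<le> P / q * 2 powr (q / 2 + 1) * (2 * T / 3) powr (q / 2)"
    using power_profile_rate[where M=M and c="\<kappa> t" and t=t,
      OF assms(1-4) kappa_pos[OF t(1)] t(1) dim rate[OF _ _ t(1)], folded q_def T_def P_def, unfolded K] .
  also have "T * power_profile q 0 (1 / T) - 2 * T * power_profile q 0 (1 / (2 * T))
      = T powr (1 - q) * D / q"
    using gap[OF T] gap[of "2 * T"] T
    by (simp add: D_def powr_mult right_diff_distrib diff_divide_distrib mult_ac)
  finally have "\<kappa> t * (T powr (1 - q) * D / q) * q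
      \<le> P / q * 2 powr (q / 2 + 1) * (2 * T / 3) powr (q / 2) * q"
    using q by (intro mult_right_mono) auto
  then have "\<kappa> t * D * T powr (1 - q) \<le> P * 2 powr (q / 2 + 1) * (2 * T / 3) powr (q / 2)"
    using q by (simp add: mult_ac)
  \<comment> \<open>This clears \<open>T\<close> on the left; on the right the exponents
    \<open>q / 2\<close> and \<open>q - 1\<close> add up to the stated one.\<close>
  then have "\<kappa> t * D * T powr (1 - q) * T powr (q - 1)
      \<le> P * 2 powr (q / 2 + 1) * (2 * T / 3) powr (q / 2) * T powr (q - 1)"
    by (rule mult_right_mono) simp
  also have "(2 * T / 3) powr (q / 2) = 2 powr (q / 2) * T powr (q / 2) / 3 powr (q / 2)"
    using T by (simp add: powr_divide powr_mult)
  also have "P * 2 powr (q / 2 + 1) * (2 powr (q / 2) * T powr (q / 2) / 3 powr (q / 2)) * T powr (q - 1)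
      = P / 3 powr (q / 2) * (T powr (q / 2) * T powr (q - 1)) * (2 powr (q / 2 + 1) * 2 powr (q / 2))"
    by (simp only: times_divide_eq_left times_divide_eq_right mult_ac)
  also have "T powr (q / 2) * T powr (q - 1) = T powr ((3 * q - 2) / 2)"
    unfolding powr_add[symmetric] by (rule arg_cong[where f="(powr) T"]) (simp add: field_simps)
  also have "2 powr (q / 2 + 1) * 2 powr (q / 2) = (2::real) powr (q + 1)"
    unfolding powr_add[symmetric] by (rule arg_cong[where f="(powr) 2"]) simp
  also have "\<kappa> t * D * T powr (1 - q) * T powr (q - 1) = \<kappa> t * D"
    unfolding mult.assoc powr_add[symmetric] using T by simp
  finally have kD: "\<kappa> t * D \<le> P / 3 powr (q / 2) * T powr ((3 * q - 2) / 2) * 2 powr (q + 1)" .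
  \<comment> \<open>The exact factor \<open>1 / D\<close> is traded for the
    \<open>1 / (q - 1)\<close> of the stated constant.\<close>
  have "2 powr (q + 1) * (q - 1) \<le> 2 powr (q + 1) * (2 powr (real p / 2 + \<nu>) * D)"
    using exponent_bound[OF assms(1,2)] by (intro mult_left_mono) (auto simp: q_def D_def)
  also have "\<dots> = 2 powr ((3 * real p + 4 * \<nu> + 2) / 2) * D"
    unfolding mult.assoc[symmetric] powr_add[symmetric]
    by (intro arg_cong[where f="\<lambda>e. 2 powr e * D"]) (simp add: q_def field_simps)
  finally have "2 powr (q + 1) \<le> 2 powr ((3 * real p + 4 * \<nu> + 2) / 2) * D / (q - 1)"
    using q by (simp add: le_divide_eq)
  then have "P / 3 powr (q / 2) * T powr ((3 * q - 2) / 2) * 2 powr (q + 1)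
      \<le> P / 3 powr (q / 2) * T powr ((3 * q - 2) / 2)
        * (2 powr ((3 * real p + 4 * \<nu> + 2) / 2) * D / (q - 1))"
    using P by (intro mult_left_mono) auto
  with kD have "\<kappa> t * D \<le> P / 3 powr (q / 2) * T powr ((3 * q - 2) / 2)
        * (2 powr ((3 * real p + 4 * \<nu> + 2) / 2) / (q - 1)) * D"
    unfolding times_divide_eq_right times_divide_eq_left mult.assoc by (rule order_trans)
  then have "\<kappa> t \<le> P / 3 powr (q / 2) * T powr ((3 * q - 2) / 2)
        * (2 powr ((3 * real p + 4 * \<nu> + 2) / 2) / (q - 1))"
    using D by (rule mult_right_le_imp_le)
  moreover have "(\<Prod>i = 0..p - 1. real p + \<nu> - real i) = P"
    unfolding P_def falling_def q_def using \<open>p \<ge> 2\<close>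
    by (intro prod.cong) auto
  ultimately show "\<kappa> t \<le> rate_const p \<nu> * real (t + 1) powr ((3 * (real p + \<nu>) - 2) / 2)"
    unfolding rate_const_def q_def[symmetric] T_def[symmetric] by (simp add: mult_ac)
qed

end
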